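(* Let $n>1$ and let $$D^{n,1}=\{(z_0,\dots,z_n)\in\mathbb{C}^{n+1}: -|z_0|^2+|z_1|^2+\cdots+|z_n|^2>0\}.$$ There is no discrete subgroup $\Gamma$ of $\mathrm{Aut}(D^{n,1})$ acting properly discontinuously on $D^{n,1}$ such that the quotient $D^{n,1}/\Gamma$ is compact.
   Context: $\mathrm{Aut}(D^{n,1})$ denotes the group of all biholomorphic self-maps of $D^{n,1}$ with the compact-open topology. *)

theory Defs
  imports "HOL-Analysis.Analysis"
begin

text \<open>Points of C^(n+1) are vectors of type complex^'n with CARD('n) = n+1.
  The distinguished coordinate z_0 is the index e0.\<close>

definition Dn1 :: "'n::finite \<Rightarrow> (complex^'n) set" where
  "Dn1 e0 = {z. - (cmod (z $ e0))\<^sup>2 + (\<Sum>i\<in>UNIV - {e0}. (cmod (z $ i))\<^sup>2) > 0}"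

definition holo_on :: "(complex^'n::finite) set \<Rightarrow> (complex^'n \<Rightarrow> complex^'n) \<Rightarrow> bool" where
  "holo_on S f \<longleftrightarrow> (\<forall>x\<in>S. \<exists>L. (f has_derivative L) (at x) \<and>
        (\<forall>c v. L (c *s v) = c *s L v))"

text \<open>Automorphisms (biholomorphic self-maps) of an open set S.  Maps are normalised
  to be the identity outside S so that they form a group under composition.\<close>
definition aut_inv :: "(complex^'n::finite) set \<Rightarrow> (complex^'n \<Rightarrow> complex^'n) \<Rightarrow> complex^'n \<Rightarrow> complex^'n" where
  "aut_inv S f = (\<lambda>z. if z \<in> S then inv_into S f z else z)"

definition Aut :: "(complex^'n::finite) set \<Rightarrow> (complex^'n \<Rightarrow> complex^'n) set" where
  "Aut S = {f. bij_betw f S S \<and> holo_on S f \<and> holo_on S (aut_inv S f) \<and> (\<forall>z. z \<notin> S \<longrightarrow> f z = z)}"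

definition aut_subgroup :: "(complex^'n::finite) set \<Rightarrow> (complex^'n \<Rightarrow> complex^'n) set \<Rightarrow> bool" where
  "aut_subgroup S G \<longleftrightarrow> G \<subseteq> Aut S \<and> id \<in> G \<and> (\<forall>f\<in>G. \<forall>g\<in>G. f \<circ> g \<in> G) \<and>
     (\<forall>f\<in>G. aut_inv S f \<in> G)"

definition compact_open_aut :: "(complex^'n::finite) set \<Rightarrow> (complex^'n \<Rightarrow> complex^'n) topology" where
  "compact_open_aut S = subtopology
     (topology_generated_by {{f. f ` K \<subseteq> U} | K U. compact K \<and> K \<subseteq> S \<and> open U}) (Aut S)"

definition discrete_in_aut :: "(complex^'n::finite) set \<Rightarrow> (complex^'n \<Rightarrow> complex^'n) set \<Rightarrow> bool" where
  "discrete_in_aut S G \<longleftrightarrow> (\<forall>g\<in>G. \<exists>V. openin (compact_open_aut S) V \<and> V \<inter> G = {g})"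

definition properly_discontinuous :: "(complex^'n::finite) set \<Rightarrow> (complex^'n \<Rightarrow> complex^'n) set \<Rightarrow> bool" where
  "properly_discontinuous S G \<longleftrightarrow>
     (\<forall>K. compact K \<and> K \<subseteq> S \<longrightarrow> finite {g\<in>G. g ` K \<inter> K \<noteq> {}})"

definition orbit_map :: "(complex^'n::finite \<Rightarrow> complex^'n) set \<Rightarrow> complex^'n \<Rightarrow> (complex^'n) set" where
  "orbit_map G x = {g x | g. g \<in> G}"

definition compact_quotient :: "(complex^'n::finite) set \<Rightarrow> (complex^'n \<Rightarrow> complex^'n) set \<Rightarrow> bool" where
  "compact_quotient S G \<longleftrightarrow>
     (\<exists>Y. quotient_map (top_of_set S) Y (orbit_map G) \<and> compact_space Y)"

end

theory Submission
  imports Defs "HOL-Complex_Analysis.Conformal_Mappings"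
begin

text \<open>
  Let q be the form defining Dn1.  Holomorphic functions on Dn1 extend to all of the ambient space:
  Cauchy's integral over a large circle in one positive coordinate defines the extension, and a
  second positive coordinate is needed to identify it with the given function.  Hence an
  automorphism extends to a bijection F of the ambient space preserving the cone q \<le> 0.  Along a
  complex line through 0 in that cone every component of F is dominated by the component e0, so by
  Liouville F maps the line bijectively onto another such line; this forces F 0 = 0 and F to be
  homogeneous, hence linear.  A linear map preserving Dn1 multiplies q by a constant \<mu>.

  As in the Calabi--Markus phenomenon, F maps some unit vector of the positive definite hyperplane
  z e0 = 0 into that hyperplane, where q is the squared norm.  So in a properly discontinuous group
  only finitely many elements have \<mu> in a given compact subset of the positive reals.  If the
  quotient were compact, the level set q = 1 would be covered by the images of a compact set under
  finitely many elements, but this level set is unbounded.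

  Holomorphy of the extension is expressed through its restrictions to holomorphic curves, which
  is stable under composition and reduces everything to functions of one variable.
\<close>

section \<open>Holomorphic functions of one variable\<close>

text \<open>By Morera's theorem: the integral depends continuously on the parameter, and its
  integral over a triangle in \<open>U\<close> can be exchanged with the circle integral, where
  Cauchy's theorem kills the inner one for each fixed \<open>w\<close>.\<close>

lemma holomorphic_on_contour_integral_circlepath:
  fixes \<phi> :: "complex \<Rightarrow> complex \<Rightarrow> complex"
  assumes U: "open U"
    and cont: "continuous_on (U \<times> path_image (circlepath z r)) (\<lambda>(t, w). \<phi> t w)"
    and hol: "\<And>w. w \<in> path_image (circlepath z r) \<Longrightarrow> (\<lambda>t. \<phi> t w) holomorphic_on U"
  shows "(\<lambda>t. contour_integral (circlepath z r) (\<phi> t)) holomorphic_on U"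
proof -
  let ?C = "circlepath z r"
  let ?I = "\<lambda>t. contour_integral ?C (\<phi> t)"
  have vcirc: "continuous_on {0..1} (\<lambda>t. vector_derivative ?C (at t))"
    unfolding vector_derivative_circlepath by (intro continuous_intros)
  have I_eq: "?I = (\<lambda>t. integral (cbox 0 1) (\<lambda>x. \<phi> t (?C x) * vector_derivative ?C (at x)))"
    by (simp add: contour_integral_integral)
  have "continuous_on U ?I"
    unfolding I_eq
  proof (rule integral_continuous_on_param)
    have "continuous_on (U \<times> cbox 0 1) ((\<lambda>(t, w). \<phi> t w) \<circ> (\<lambda>(t, x). (t, ?C x)))"
      by (intro continuous_on_compose continuous_on_subset [OF cont])
        (auto simp: split_def circlepath path_image_def intro!: continuous_intros)
    moreover have "continuous_on (U \<times> cbox (0::real) 1) (\<lambda>p. vector_derivative ?C (at (snd p)))"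
      unfolding vector_derivative_circlepath by (intro continuous_intros)
    ultimately show "continuous_on (U \<times> cbox 0 1)
        (\<lambda>(t, x). \<phi> t (?C x) * vector_derivative ?C (at x))"
      by (auto simp: split_def o_def intro: continuous_on_mult)
  qed
  moreover have "contour_integral (linepath a b) ?I + contour_integral (linepath b c) ?I
      + contour_integral (linepath c a) ?I = 0" if abc: "convex hull {a, b, c} \<subseteq> U" for a b c
  proof -
    have seg: "closed_segment a b \<subseteq> U" "closed_segment b c \<subseteq> U" "closed_segment c a \<subseteq> U"
      by (rule order_trans [OF _ abc], rule segments_subset_convex_hull)+
    have swap: "contour_integral (linepath p q) ?I
        = contour_integral ?C (\<lambda>w. contour_integral (linepath p q) (\<lambda>t. \<phi> t w))"
      if "closed_segment p q \<subseteq> U" for p q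
      using that vcirc
      by (intro contour_integral_swap continuous_on_subset [OF cont]) auto
    have integrable: "(\<lambda>w. contour_integral (linepath p q) (\<lambda>t. \<phi> t w)) contour_integrable_on ?C"
      if pq: "closed_segment p q \<subseteq> U" for p q
    proof (rule contour_integrable_continuous_circlepath)
      have "(\<lambda>w. contour_integral (linepath p q) (\<lambda>t. \<phi> t w))
          = (\<lambda>w. integral (cbox 0 1) (\<lambda>x. \<phi> (linepath p q x) w * (q - p)))"
        by (simp add: contour_integral_integral)
      moreover have "continuous_on (path_image ?C)
          (\<lambda>w. integral (cbox 0 1) (\<lambda>x. \<phi> (linepath p q x) w * (q - p)))"
      proof (rule integral_continuous_on_param)
        have "linepath p q x \<in> U" if "x \<in> {0..1}" for x
          using that pq linepath_image_01 [of p q] by blast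
        then have "continuous_on (path_image ?C \<times> cbox 0 1)
            ((\<lambda>(t, w). \<phi> t w) \<circ> (\<lambda>(w, x). (linepath p q x, w)))"
          by (intro continuous_on_compose continuous_on_subset [OF cont])
            (auto simp: split_def linepath_def intro!: continuous_intros)
        then show "continuous_on (path_image ?C \<times> cbox 0 1)
            (\<lambda>(w, x). \<phi> (linepath p q x) w * (q - p))"
          by (auto simp: split_def o_def intro: continuous_on_mult)
      qed
      ultimately show "continuous_on (path_image ?C)
          (\<lambda>w. contour_integral (linepath p q) (\<lambda>t. \<phi> t w))"
        by (simp only:)
    qed
    have zero: "contour_integral (linepath a b) (\<lambda>t. \<phi> t w)
        + contour_integral (linepath b c) (\<lambda>t. \<phi> t w)
        + contour_integral (linepath c a) (\<lambda>t. \<phi> t w) = 0" if w: "w \<in> path_image ?C" for w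
    proof -
      have h: "(\<lambda>t. \<phi> t w) holomorphic_on convex hull {a, b, c}"
        using hol [OF w] abc holomorphic_on_subset by blast
      have ci: "(\<lambda>t. \<phi> t w) contour_integrable_on linepath p q" if "closed_segment p q \<subseteq> U" for p q
        using contour_integrable_holomorphic_simple [OF hol [OF w] U] that by simp
      have "((\<lambda>t. \<phi> t w) has_contour_integral 0) (linepath a b +++ linepath b c +++ linepath c a)"
        by (rule Cauchy_theorem_triangle [OF h])
      then have "contour_integral (linepath a b +++ linepath b c +++ linepath c a) (\<lambda>t. \<phi> t w) = 0"
        by (rule contour_integral_unique)
      then show ?thesis
        using ci seg by (simp add: add.assoc)
    qed
    have "contour_integral (linepath a b) ?I + contour_integral (linepath b c) ?I
        + contour_integral (linepath c a) ?I
      = contour_integral ?C (\<lambda>w. contour_integral (linepath a b) (\<lambda>t. \<phi> t w)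
          + contour_integral (linepath b c) (\<lambda>t. \<phi> t w)
          + contour_integral (linepath c a) (\<lambda>t. \<phi> t w))"
      using seg by (simp add: swap integrable contour_integral_add contour_integrable_add)
    also have "\<dots> = contour_integral ?C (\<lambda>w. 0)"
      by (rule contour_integral_eq) (use zero in auto)
    finally show ?thesis
      by simp
  qed
  ultimately have "?I analytic_on U"
    by (intro Morera_triangle U) auto
  then show ?thesis
    by (rule analytic_imp_holomorphic)
qed

text \<open>The quotient f / g is bounded by 1, so its only possible singularity \<open>t0\<close>
  is removable and Liouville makes it constant.\<close>

lemma entire_norm_le_imp_proportional:
  fixes f g :: "complex \<Rightarrow> complex"
  assumes f: "f holomorphic_on UNIV" and g: "g holomorphic_on UNIV"
    and le: "\<And>t. norm (f t) \<le> norm (g t)"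
    and zero: "\<And>t. g t = 0 \<Longrightarrow> t = t0"
  shows "\<exists>c. \<forall>t. f t = c * g t"
proof -
  have hol: "(\<lambda>t. f t / g t) holomorphic_on UNIV - {t0}"
    using f g zero by (intro holomorphic_intros) (auto intro: holomorphic_on_subset)
  \<comment> \<open>At a zero of \<open>g\<close> the quotient is 0 by the convention on division,
    so the bound holds there as well.\<close>
  have bd: "norm (f t / g t) \<le> 1" for t
    using le [of t] by (cases "g t = 0") (auto simp: norm_divide divide_le_eq_1)
  then have "\<exists>h. h holomorphic_on UNIV \<and> (\<forall>t\<in>UNIV - {t0}. h t = f t / g t)"
    by (subst holomorphic_on_extend_bounded [OF hol]) (auto intro!: exI [of _ 1])
  then obtain h where h: "h holomorphic_on UNIV" "\<And>t. t \<noteq> t0 \<Longrightarrow> h t = f t / g t"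
    by auto
  have "norm (h t) \<le> max 1 (norm (h t0))" for t
    using h(2) [of t] bd [of t] by (cases "t = t0") auto
  then have "bounded (range h)"
    by (auto intro: boundedI)
  then have "h constant_on UNIV"
    using h(1) by (intro Liouville_theorem)
  then obtain c where c: "\<And>t. h t = c"
    by (auto simp: constant_on_def)
  have fc: "f t = c * g t" if "t \<noteq> t0" for t
    using h(2) [OF that] c [of t] zero [of t] that by (auto simp: field_simps)
  \<comment> \<open>The point \<open>t0\<close> is recovered by the identity theorem.\<close>
  have "f t = c * g t" for t
    by (rule analytic_continuation_open [of "- {t0}" UNIV])
      (use f g fc in \<open>auto intro!: holomorphic_intros simp: ex_in_conv [symmetric] intro: exI [of _ "t0 + 1"]\<close>)
  then show ?thesis
    by blast
qed

text \<open>The left inverse makes \<open>f\<close> proper, so \<open>f\<close> has a pole at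
  infinity and is a polynomial. The chain rule applied to g (f t) = t shows that its derivative
  never vanishes, hence is constant by the fundamental theorem of algebra.\<close>

lemma entire_automorphism_fixing_0_linear:
  fixes f g :: "complex \<Rightarrow> complex"
  assumes f: "f holomorphic_on UNIV" and g: "g holomorphic_on UNIV"
    and gf: "\<And>t. g (f t) = t" and f0: "f 0 = 0"
  shows "f t = t * f 1"
proof -
  have "filterlim f at_infinity at_infinity"
    unfolding filterlim_at_infinity [of 0, OF order_refl]
  proof (intro allI impI)
    fix r :: real assume "0 < r"
    have "compact (g ` cball 0 r)"
      using g by (intro compact_continuous_image)
        (auto intro: holomorphic_on_imp_continuous_on holomorphic_on_subset)
    then obtain M where M: "\<And>x. x \<in> g ` cball 0 r \<Longrightarrow> norm x \<le> M"
      using compact_imp_bounded bounded_iff by metis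
    have "r \<le> norm (f t)" if "M + 1 \<le> norm t" for t
    proof (rule ccontr)
      assume "\<not> r \<le> norm (f t)"
      then have "f t \<in> cball 0 r"
        by simp
      then have "g (f t) \<in> g ` cball 0 r"
        by (rule imageI)
      then show False
        using M [of t] that gf by simp
    qed
    then show "\<forall>\<^sub>F t in at_infinity. r \<le> norm (f t)"
      unfolding eventually_at_infinity by blast
  qed
  then have "((inverse \<circ> f) \<longlongrightarrow> 0) at_infinity"
    unfolding o_def by (rule filterlim_compose [OF tendsto_inverse_0])
  then obtain a n where an: "\<And>t. f t = (\<Sum>i\<le>n. a i * t ^ i)"
    using pole_at_infinity [OF f] by metis
  \<comment> \<open>The coefficients of the derivative of \<open>f\<close>.\<close>
  define b where "b i = of_nat (Suc i) * a (Suc i)" for i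
  have f_eq: "f = (\<lambda>t. \<Sum>i<n. a (Suc i) * t ^ Suc i)"
  proof
    fix t
    have "f t = a 0 + (\<Sum>i<n. a (Suc i) * t ^ Suc i)" for t
      by (simp add: an sum.atMost_shift)
    from this [of 0] this [of t] show "f t = (\<Sum>i<n. a (Suc i) * t ^ Suc i)"
      using f0 by simp
  qed
  have deriv: "(f has_field_derivative (\<Sum>i<n. b i * t ^ i)) (at t)" for t
    unfolding f_eq b_def
    by (auto intro!: derivative_eq_intros sum.cong simp del: power_Suc simp: algebra_simps)
  have nz: "(\<Sum>i<n. b i * t ^ i) \<noteq> 0" for t
  proof
    assume "(\<Sum>i<n. b i * t ^ i) = 0"
    with deriv [of t] have "(f has_field_derivative 0) (at t)"
      by simp
    moreover obtain g' where "(g has_field_derivative g') (at (f t))"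
      using g unfolding holomorphic_on_def by (auto simp: field_differentiable_def)
    ultimately have "((\<lambda>t. g (f t)) has_field_derivative g' * 0) (at t)"
      by (intro DERIV_chain2)
    then have "((\<lambda>t. t) has_field_derivative 0) (at t)"
      using gf by simp
    then show False
      using DERIV_unique [OF DERIV_ident] by fastforce
  qed
  \<comment> \<open>For n = 0 the derivative would be the empty sum, which vanishes.\<close>
  then obtain m where m: "n = Suc m"
    using nz [of 0] by (cases n) auto
  have "b i = 0" if "i \<in> {1..m}" for i
  proof (rule ccontr)
    assume "b i \<noteq> 0"
    then have "b 0 = 0 \<or> (\<exists>i\<in>{1..m}. b i \<noteq> 0)"
      using that by blast
    then obtain t where "(\<Sum>i\<le>m. b i * t ^ i) = 0"
      by (rule fundamental_theorem_of_algebra)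
    then show False
      using nz [of t] by (simp add: m lessThan_Suc_atMost)
  qed
  then have "a (Suc i) = 0" if "i \<in> {1..m}" for i
    using that by (force simp: b_def simp del: of_nat_Suc)
  then have "f t = a 1 * t" for t
    by (simp add: f_eq m sum.lessThan_Suc_shift del: sum.lessThan_Suc)
  then show ?thesis
    by simp
qed

section \<open>Hartogs extension from Dn1\<close>

definition herm_form :: "'n::finite \<Rightarrow> complex^'n \<Rightarrow> real" where
  "herm_form e0 z = (\<Sum>i\<in>UNIV - {e0}. (cmod (z $ i))\<^sup>2) - (cmod (z $ e0))\<^sup>2"

lemma Dn1_eq: "Dn1 e0 = {z. 0 < herm_form e0 z}"
  by (auto simp: Dn1_def herm_form_def)

lemma continuous_on_herm_form [continuous_intros]: "continuous_on S (herm_form e0)"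
  unfolding herm_form_def by (intro continuous_intros)

lemma open_Dn1: "open (Dn1 e0)"
  unfolding Dn1_eq by (intro open_Collect_less continuous_intros)

lemma mem_Dn1_if_component_gt:
  assumes "i \<noteq> e0" "cmod (z $ e0) < cmod (z $ i)"
  shows "z \<in> Dn1 e0"
proof -
  have "(cmod (z $ e0))\<^sup>2 < (cmod (z $ i))\<^sup>2"
    using assms by (intro power_strict_mono) auto
  also have "\<dots> \<le> (\<Sum>i\<in>UNIV - {e0}. (cmod (z $ i))\<^sup>2)"
    using assms by (intro member_le_sum) auto
  finally show ?thesis
    by (simp add: Dn1_def)
qed

section \<open>Holomorphic curves and functions holomorphic along them\<close>

definition vec_upd :: "complex^'n \<Rightarrow> 'n::finite \<Rightarrow> complex \<Rightarrow> complex^'n" where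
  "vec_upd z i w = (\<chi> j. if j = i then w else z $ j)"

lemma vec_upd_nth [simp]: "vec_upd z i w $ j = (if j = i then w else z $ j)"
  by (simp add: vec_upd_def)

lemma vec_upd_same [simp]: "vec_upd z i (z $ i) = z"
  by (simp add: vec_eq_iff)

definition hol_curve :: "complex set \<Rightarrow> (complex \<Rightarrow> complex^'n::finite) \<Rightarrow> bool" where
  "hol_curve U c \<longleftrightarrow> (\<forall>i. (\<lambda>t. c t $ i) holomorphic_on U)"

definition curve_holomorphic :: "(complex^'n::finite) set \<Rightarrow> (complex^'n \<Rightarrow> complex) \<Rightarrow> bool" where
  "curve_holomorphic S h \<longleftrightarrow>
     (\<forall>U c. open U \<longrightarrow> hol_curve U c \<longrightarrow> c ` U \<subseteq> S \<longrightarrow> (\<lambda>t. h (c t)) holomorphic_on U)"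

lemma curve_holomorphicD:
  assumes "curve_holomorphic S h" "open U" "hol_curve U c" "\<And>t. t \<in> U \<Longrightarrow> c t \<in> S"
  shows "(\<lambda>t. h (c t)) holomorphic_on U"
  using assms unfolding curve_holomorphic_def by blast

lemma hol_curve_imp_continuous_on: "hol_curve U c \<Longrightarrow> continuous_on U c"
  using continuous_on_vec_lambda [of U "\<lambda>i t. c t $ i"]
  by (simp add: hol_curve_def holomorphic_on_imp_continuous_on)

lemma hol_curve_line [intro, simp]: "hol_curve U (\<lambda>t. p + t *s v)"
  by (auto simp: hol_curve_def intro!: holomorphic_intros)

lemma hol_curve_scale [intro, simp]: "hol_curve U (\<lambda>t. t *s v)"
  by (auto simp: hol_curve_def intro!: holomorphic_intros)

lemma hol_curve_vec_upd [intro, simp]: "hol_curve U (vec_upd p i)"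
  unfolding hol_curve_def
proof
  fix j show "(\<lambda>t. vec_upd p i t $ j) holomorphic_on U"
    by (cases "j = i") (auto intro!: holomorphic_intros)
qed

lemma hol_curve_vec_upd_const:
  assumes "hol_curve U c"
  shows "hol_curve U (\<lambda>t. vec_upd (c t) i w)"
  unfolding hol_curve_def
proof
  fix j show "(\<lambda>t. vec_upd (c t) i w $ j) holomorphic_on U"
    using assms by (cases "j = i") (auto simp: hol_curve_def)
qed

lemma continuous_on_vec_upd [continuous_intros]:
  assumes "continuous_on S f" "continuous_on S g"
  shows "continuous_on S (\<lambda>x. vec_upd (f x) i (g x))"
  unfolding vec_upd_def
proof (rule continuous_on_vec_lambda)
  fix j show "continuous_on S (\<lambda>x. if j = i then g x else f x $ j)"
    using assms by (cases "j = i") (auto intro!: continuous_intros)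
qed

lemma holo_on_imp_continuous_on: "holo_on S f \<Longrightarrow> continuous_on S f"
  unfolding holo_on_def
  by (meson continuous_at_imp_continuous_on has_derivative_continuous)

text \<open>Chain rule: the real derivative along a curve with velocity \<open>d\<close> is s
  \<mapsto> L (s *s d), and complex homogeneity of \<open>L\<close> turns this into multiplication
  by a complex number.\<close>

lemma holo_on_imp_curve_holomorphic:
  assumes "holo_on S f"
  shows "curve_holomorphic S (\<lambda>z. f z $ j)"
  unfolding curve_holomorphic_def
proof (intro allI impI)
  fix U c assume U: "open U" "hol_curve U c" "c ` U \<subseteq> S"
  show "(\<lambda>t. f (c t) $ j) holomorphic_on U"
    unfolding holomorphic_on_open [OF U(1)]
  proof
    fix t assume t: "t \<in> U"
    then obtain L where L: "(f has_derivative L) (at (c t))" "\<And>a v. L (a *s v) = a *s L v"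
      using assms U(3) unfolding holo_on_def by blast
    define d where "d = (\<chi> i. deriv (\<lambda>t. c t $ i) t)"
    have "((\<lambda>t. c t $ i) has_field_derivative d $ i) (at t)" for i
      using U(1,2) t unfolding hol_curve_def d_def by (auto intro: holomorphic_derivI)
    then have "((\<lambda>t. c t $ i) has_derivative (\<lambda>s. (s *s d) $ i)) (at t)" for i
      by (simp add: has_field_derivative_def mult_commute_abs)
    then have "(c has_derivative (\<lambda>s. s *s d)) (at t)"
      by (subst has_derivative_componentwise_within)
        (auto simp: Basis_vec_def inner_axis intro: has_derivative_inner_left)
    then have "((\<lambda>t. f (c t)) has_derivative (\<lambda>s. L (s *s d))) (at t)"
      using L(1) by (rule has_derivative_compose)
    then have "((\<lambda>t. f (c t) $ j) has_derivative (\<lambda>s. L (s *s d) $ j)) (at t)"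
      by (rule bounded_linear.has_derivative [OF bounded_linear_vec_nth])
    then have "((\<lambda>t. f (c t) $ j) has_field_derivative L d $ j) (at t)"
      unfolding has_field_derivative_def by (simp add: L(2) mult.commute[of _ "L d $ j"])
    then show "\<exists>f'. ((\<lambda>t. f (c t) $ j) has_field_derivative f') (at t)"
      by blast
  qed
qed

text \<open>Restricting to the complex line through \<open>p\<close> and \<open>z\<close> reduces
  this to the identity theorem in one variable; convexity of \<Omega> makes the parameter set
  connected.\<close>

lemma curve_holomorphic_eq_on_convex:
  assumes h: "curve_holomorphic \<Omega> h" and k: "curve_holomorphic \<Omega> k"
    and \<Omega>: "open \<Omega>" "convex \<Omega>" and A: "open A" "A \<subseteq> \<Omega>" "p \<in> A"
    and eq: "\<And>z. z \<in> A \<Longrightarrow> h z = k z" and z: "z \<in> \<Omega>"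
  shows "h z = k z"
proof -
  define c where "c = (\<lambda>t. p + t *s (z - p))"
  have cc: "continuous_on UNIV c" "\<And>U. hol_curve U c"
    unfolding c_def by (intro hol_curve_imp_continuous_on hol_curve_line)+
  have c01: "c 0 = p" "c 1 = z"
    by (auto simp: c_def vec_eq_iff)
  have cv: "convex (c -` \<Omega>)"
  proof (rule convexI)
    fix x y :: complex and u v :: real
    assume xy: "x \<in> c -` \<Omega>" "y \<in> c -` \<Omega>" and uv: "0 \<le> u" "0 \<le> v" "u + v = 1"
    have "c (u *\<^sub>R x + v *\<^sub>R y) = (u + v) *\<^sub>R p + (u *\<^sub>R x + v *\<^sub>R y) *s (z - p)"
      by (simp add: c_def uv)
    also have "\<dots> = u *\<^sub>R c x + v *\<^sub>R c y"
      by (simp add: c_def vec_eq_iff algebra_simps)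
    finally have "c (u *\<^sub>R x + v *\<^sub>R y) = u *\<^sub>R c x + v *\<^sub>R c y" .
    then show "u *\<^sub>R x + v *\<^sub>R y \<in> c -` \<Omega>"
      using \<Omega>(2) xy uv by (simp add: convexD)
  qed
  have op: "open (c -` \<Omega>)" "open (c -` A)"
    using cc(1) \<Omega>(1) A(1) by (auto intro: open_vimage)
  have "h (c 1) = k (c 1)"
  proof (rule analytic_continuation_open [of "c -` A" "c -` \<Omega>" "\<lambda>t. h (c t)" "\<lambda>t. k (c t)"])
    show "c -` A \<noteq> {}"
      using A(3) c01(1) by blast
    show "(\<lambda>t. h (c t)) holomorphic_on c -` \<Omega>" "(\<lambda>t. k (c t)) holomorphic_on c -` \<Omega>"
      using h k op cc by (auto intro: curve_holomorphicD)
  qed (use op A c01 z eq cv convex_connected in auto)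
  then show ?thesis
    by (simp add: c01)
qed

section \<open>Extension by Cauchy's integral\<close>

definition hartogs :: "'n::finite \<Rightarrow> real \<Rightarrow> (complex^'n \<Rightarrow> complex) \<Rightarrow> complex^'n \<Rightarrow> complex" where
  "hartogs e1 R h z =
     contour_integral (circlepath 0 R) (\<lambda>w. h (vec_upd z e1 w) / (w - z $ e1)) / (2 * of_real pi * \<i>)"

text \<open>The bound on coordinate \<open>e0\<close> keeps the circle of integration of
  \<open>hartogs\<close> inside \<open>Dn1\<close>; the bound on \<open>e1\<close> puts the point of
  evaluation inside that circle. The remaining coordinates are free.\<close>

definition bicylinder :: "'n::finite \<Rightarrow> 'n \<Rightarrow> real \<Rightarrow> (complex^'n) set" where
  "bicylinder e0 e1 R = {z. cmod (z $ e0) < R \<and> cmod (z $ e1) < R}"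

lemma open_bicylinder: "open (bicylinder e0 e1 R)"
proof -
  have "bicylinder e0 e1 R = {z. cmod (z $ e0) < R} \<inter> {z. cmod (z $ e1) < R}"
    by (auto simp: bicylinder_def)
  then show ?thesis
    by (auto intro!: open_Int open_Collect_less continuous_intros)
qed

lemma convex_bicylinder: "convex (bicylinder e0 e1 R)"
proof -
  have "bicylinder e0 e1 R = (\<lambda>z. z $ e0) -` ball 0 R \<inter> (\<lambda>z. z $ e1) -` ball 0 R"
    by (auto simp: bicylinder_def)
  then show ?thesis
    by (auto intro!: convex_Int convex_linear_vimage bounded_linear.linear bounded_linear_vec_nth)
qed

context
  fixes e0 e1 e2 :: "'n::finite" and h :: "complex^'n \<Rightarrow> complex"
  assumes e: "e1 \<noteq> e0" "e2 \<noteq> e0" "e2 \<noteq> e1"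
    and hol: "curve_holomorphic (Dn1 e0) h" and cont: "continuous_on (Dn1 e0) h"
begin

text \<open>Holomorphic dependence of a circle integral on a parameter. Curve holomorphy gives the
  integrand holomorphic in \<open>t\<close>, and continuity of \<open>h\<close> gives it jointly
  continuous.\<close>

lemma hartogs_curve_holomorphic: "curve_holomorphic (bicylinder e0 e1 R) (hartogs e1 R h)"
  unfolding curve_holomorphic_def
proof (intro allI impI)
  fix U c assume U: "open U" "hol_curve U c" "c ` U \<subseteq> bicylinder e0 e1 R"
  show "(\<lambda>t. hartogs e1 R h (c t)) holomorphic_on U"
  proof (cases "U = {}")
    case False
    then obtain t0 where "cmod (c t0 $ e0) < R"
      using U(3) by (auto simp: bicylinder_def)
    then have R: "0 < R"
      using norm_ge_zero [of "c t0 $ e0"] by linarith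
    have D: "vec_upd (c t) e1 w \<in> Dn1 e0" and ne: "w - c t $ e1 \<noteq> 0"
      if "t \<in> U" "w \<in> path_image (circlepath 0 R)" for t w
      using that U(3) R e by (auto simp: bicylinder_def intro!: mem_Dn1_if_component_gt [of e1])
    have "(\<lambda>t. contour_integral (circlepath 0 R) (\<lambda>w. h (vec_upd (c t) e1 w) / (w - c t $ e1)))
        holomorphic_on U"
    proof (rule holomorphic_on_contour_integral_circlepath [OF U(1)])
      have cc: "continuous_on (U \<times> path_image (circlepath 0 R)) (\<lambda>x. c (fst x))"
        by (rule continuous_on_compose2 [OF hol_curve_imp_continuous_on [OF U(2)]])
          (auto intro!: continuous_intros)
      have "continuous_on (U \<times> path_image (circlepath 0 R)) (\<lambda>x. h (vec_upd (c (fst x)) e1 (snd x)))"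
        by (rule continuous_on_compose2 [OF cont])
          (use D cc in \<open>auto intro!: continuous_on_vec_upd continuous_on_snd continuous_on_id simp del: path_image_circlepath\<close>)
      then show "continuous_on (U \<times> path_image (circlepath 0 R))
          (\<lambda>(t, w). h (vec_upd (c t) e1 w) / (w - c t $ e1))"
        unfolding split_def using ne by (intro continuous_intros cc) auto
    next
      fix w assume w: "w \<in> path_image (circlepath 0 R)"
      have "(\<lambda>t. h (vec_upd (c t) e1 w)) holomorphic_on U"
        using D w U by (intro curve_holomorphicD [OF hol] hol_curve_vec_upd_const)
      then show "(\<lambda>t. h (vec_upd (c t) e1 w) / (w - c t $ e1)) holomorphic_on U"
        using ne w U(2) by (intro holomorphic_intros) (auto simp: hol_curve_def)
    qed
    then show ?thesis
      unfolding hartogs_def by (intro holomorphic_intros) auto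
  qed (simp add: holomorphic_on_def)
qed

text \<open>When coordinate \<open>e2\<close> alone dominates \<open>e0\<close>, the whole complex
  line in direction \<open>e1\<close> lies in \<open>Dn1\<close>, so Cauchy's formula applies on the
  full disc.\<close>

lemma hartogs_eq_if_component_gt:
  assumes z: "z \<in> bicylinder e0 e1 R" and gt: "cmod (z $ e0) < cmod (z $ e2)"
  shows "hartogs e1 R h z = h z"
proof -
  have "vec_upd z e1 w \<in> Dn1 e0" for w
    using e gt by (intro mem_Dn1_if_component_gt [of e2]) auto
  then have "(\<lambda>w. h (vec_upd z e1 w)) holomorphic_on UNIV"
    by (intro curve_holomorphicD [OF hol]) auto
  then have "((\<lambda>w. h (vec_upd z e1 w) / (w - z $ e1)) has_contour_integral
      (2 * of_real pi * \<i> * h (vec_upd z e1 (z $ e1)))) (circlepath 0 R)"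
    using z by (intro Cauchy_integral_circlepath_simple)
      (auto simp: bicylinder_def intro: holomorphic_on_subset)
  then show ?thesis
    by (simp add: hartogs_def contour_integral_unique)
qed

text \<open>Shrinking the coordinate e0 to 0 inside Dn1 reaches the region where Cauchy's formula
  in the coordinate e1 applies, and the identity theorem carries the equality back.\<close>

lemma hartogs_eq_if_component_nonzero:
  assumes z: "z \<in> bicylinder e0 e1 R" "z \<in> Dn1 e0" and nz: "z $ e2 \<noteq> 0"
  shows "hartogs e1 R h z = h z"
proof -
  \<comment> \<open>Coordinate \<open>e0\<close> may be replaced by any number of modulus below
    \<rho> without leaving the bicylinder or \<open>Dn1\<close>.\<close>
  define \<rho> where "\<rho> = min R (sqrt (\<Sum>i\<in>UNIV - {e0}. (cmod (z $ i))\<^sup>2))"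
  have z0: "cmod (z $ e0) < \<rho>"
    using z by (auto simp: \<rho>_def bicylinder_def Dn1_def intro: real_less_rsqrt)
  then have \<rho>: "0 < \<rho>"
    using norm_ge_zero [of "z $ e0"] by linarith
  have D: "vec_upd z e0 t \<in> Dn1 e0" and B: "vec_upd z e0 t \<in> bicylinder e0 e1 R"
    if t: "cmod t < \<rho>" for t
  proof -
    have "(\<Sum>i\<in>UNIV - {e0}. (cmod (vec_upd z e0 t $ i))\<^sup>2) = (\<Sum>i\<in>UNIV - {e0}. (cmod (z $ i))\<^sup>2)"
      by (intro sum.cong) auto
    moreover have "(cmod t)\<^sup>2 < (\<Sum>i\<in>UNIV - {e0}. (cmod (z $ i))\<^sup>2)"
      using t by (subst real_sqrt_less_iff [symmetric]) (simp add: \<rho>_def)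
    ultimately show "vec_upd z e0 t \<in> Dn1 e0"
      by (simp add: Dn1_def)
    show "vec_upd z e0 t \<in> bicylinder e0 e1 R"
      using t z e by (auto simp: bicylinder_def \<rho>_def)
  qed
  have "hartogs e1 R h (vec_upd z e0 (z $ e0)) = h (vec_upd z e0 (z $ e0))"
  proof (rule analytic_continuation_open [of "ball 0 (min \<rho> (cmod (z $ e2)))" "ball 0 \<rho>"
        "\<lambda>t. hartogs e1 R h (vec_upd z e0 t)" "\<lambda>t. h (vec_upd z e0 t)"])
    show "ball 0 (min \<rho> (cmod (z $ e2))) \<noteq> {}"
      using \<rho> nz by (simp add: not_le)
    show "(\<lambda>t. hartogs e1 R h (vec_upd z e0 t)) holomorphic_on ball 0 \<rho>"
      using B by (intro curve_holomorphicD [OF hartogs_curve_holomorphic]) auto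
    show "(\<lambda>t. h (vec_upd z e0 t)) holomorphic_on ball 0 \<rho>"
      using D by (intro curve_holomorphicD [OF hol]) auto
    show "hartogs e1 R h (vec_upd z e0 t) = h (vec_upd z e0 t)"
      if "t \<in> ball 0 (min \<rho> (cmod (z $ e2)))" for t
      using that B e by (intro hartogs_eq_if_component_gt) auto
  qed (use z0 in auto)
  then show ?thesis
    by simp
qed

text \<open>The slice where coordinate \<open>e2\<close> vanishes is reached by perturbing that
  coordinate: equality holds on a punctured disc of its values, hence at the centre.\<close>

lemma hartogs_eq:
  assumes z: "z \<in> bicylinder e0 e1 R" "z \<in> Dn1 e0"
  shows "hartogs e1 R h z = h z"
proof (cases "z $ e2 = 0")
  case True
  define S where "S = bicylinder e0 e1 R \<inter> Dn1 e0"
  have "open (vec_upd z e2 -` S)"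
    unfolding S_def using open_bicylinder open_Dn1
    by (intro open_vimage open_Int hol_curve_imp_continuous_on) auto
  moreover have "0 \<in> vec_upd z e2 -` S"
    using z True vec_upd_same [of z e2] by (simp add: S_def)
  ultimately obtain r where r: "0 < r" "ball 0 r \<subseteq> vec_upd z e2 -` S"
    by (metis open_contains_ball)
  have "hartogs e1 R h (vec_upd z e2 0) = h (vec_upd z e2 0)"
  proof (rule analytic_continuation_open [of "ball 0 r - {0}" "ball 0 r"
        "\<lambda>t. hartogs e1 R h (vec_upd z e2 t)" "\<lambda>t. h (vec_upd z e2 t)"])
    have "of_real (r / 2) \<in> ball 0 r - {0 :: complex}"
      using r by simp
    then show "ball 0 r - {0 :: complex} \<noteq> {}"
      by blast
    show "(\<lambda>t. hartogs e1 R h (vec_upd z e2 t)) holomorphic_on ball 0 r"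
      using r by (intro curve_holomorphicD [OF hartogs_curve_holomorphic]) (auto simp: S_def)
    show "(\<lambda>t. h (vec_upd z e2 t)) holomorphic_on ball 0 r"
      using r by (intro curve_holomorphicD [OF hol]) (auto simp: S_def)
    show "hartogs e1 R h (vec_upd z e2 t) = h (vec_upd z e2 t)" if "t \<in> ball 0 r - {0}" for t
      using that r by (intro hartogs_eq_if_component_nonzero) (auto simp: S_def)
  qed (use r in auto)
  then show ?thesis
    using True vec_upd_same [of z e2] by simp
qed (use hartogs_eq_if_component_nonzero z in blast)

text \<open>Both integrals agree with \<open>h\<close> on the part of the smaller bicylinder inside
  \<open>Dn1\<close>, which is open and nonempty; the identity theorem on the convex bicylinder does
  the rest.\<close>

lemma hartogs_radius_mono:
  assumes "R \<le> R'" and z: "z \<in> bicylinder e0 e1 R"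
  shows "hartogs e1 R h z = hartogs e1 R' h z"
proof (rule curve_holomorphic_eq_on_convex)
  have R: "0 < R"
    using z le_less_trans [OF norm_ge_zero] by (auto simp: bicylinder_def)
  have sub: "bicylinder e0 e1 R \<subseteq> bicylinder e0 e1 R'"
    using assms by (auto simp: bicylinder_def)
  show "curve_holomorphic (bicylinder e0 e1 R) (hartogs e1 R h)"
    by (rule hartogs_curve_holomorphic)
  show "curve_holomorphic (bicylinder e0 e1 R) (hartogs e1 R' h)"
    using hartogs_curve_holomorphic [of R'] sub unfolding curve_holomorphic_def by blast
  show "open (bicylinder e0 e1 R \<inter> Dn1 e0)"
    by (intro open_Int open_bicylinder open_Dn1)
  show "vec_upd 0 e1 (of_real (R / 2)) \<in> bicylinder e0 e1 R \<inter> Dn1 e0"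
    using R e by (auto simp: bicylinder_def intro!: mem_Dn1_if_component_gt [of e1])
  show "hartogs e1 R h w = hartogs e1 R' h w" if "w \<in> bicylinder e0 e1 R \<inter> Dn1 e0" for w
    using that sub hartogs_eq [of w R] hartogs_eq [of w R'] by auto
qed (use z open_bicylinder convex_bicylinder in auto)

lemma mem_bicylinder_if_norm_less: "norm z < R \<Longrightarrow> z \<in> bicylinder e0 e1 R"
  using Finite_Cartesian_Product.norm_nth_le [of z e0]
    Finite_Cartesian_Product.norm_nth_le [of z e1] by (auto simp: bicylinder_def)

lemma hartogs_extension:
  "\<exists>H. curve_holomorphic UNIV H \<and> (\<forall>z\<in>Dn1 e0. H z = h z)"
proof -
  \<comment> \<open>The radius varies with \<open>z\<close>, but independence of the radius makes
    \<open>H\<close> agree on each ball with a single Cauchy integral.\<close>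
  define H where "H z = hartogs e1 (1 + norm z) h z" for z
  have H: "H z = hartogs e1 R h z" if "norm z < R" for z R
  proof (cases "1 + norm z \<le> R")
    case True
    then show ?thesis
      unfolding H_def by (intro hartogs_radius_mono mem_bicylinder_if_norm_less) auto
  next
    case False
    then show ?thesis
      unfolding H_def using that
      by (intro hartogs_radius_mono [symmetric] mem_bicylinder_if_norm_less) auto
  qed
  have "curve_holomorphic UNIV H"
    unfolding curve_holomorphic_def
  proof (intro allI impI)
    fix U c assume U: "open U" "hol_curve U (c :: complex \<Rightarrow> complex^'n)"
    have "\<exists>f'. ((\<lambda>t. H (c t)) has_field_derivative f') (at t)" if t: "t \<in> U" for t
    proof -
      define R where "R = norm (c t) + 1"
      define V where "V = {s \<in> U. norm (c s) < R}"
      have "open (U \<inter> c -` ball 0 R)"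
        using U hol_curve_imp_continuous_on by (intro continuous_open_preimage) auto
      moreover have "V = U \<inter> c -` ball 0 R"
        by (auto simp: V_def)
      ultimately have V: "open V" "t \<in> V"
        using t by (auto simp: V_def R_def)
      have "(\<lambda>s. hartogs e1 R h (c s)) holomorphic_on V"
      proof (rule curve_holomorphicD [OF hartogs_curve_holomorphic V(1)])
        show "hol_curve V c"
          using U(2) unfolding hol_curve_def V_def by (auto intro: holomorphic_on_subset)
      qed (auto simp: V_def intro: mem_bicylinder_if_norm_less)
      then have "(\<lambda>s. H (c s)) holomorphic_on V"
        by (rule holomorphic_transform) (auto simp: V_def H)
      then show ?thesis
        using V holomorphic_on_open by blast
    qed
    then show "(\<lambda>t. H (c t)) holomorphic_on U"
      using U(1) holomorphic_on_open by blast
  qed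
  moreover have "H z = h z" if "z \<in> Dn1 e0" for z
    unfolding H_def using that by (intro hartogs_eq mem_bicylinder_if_norm_less) auto
  ultimately show ?thesis
    by blast
qed

end

section \<open>Automorphisms of Dn1 are linear\<close>

lemma herm_form_scale: "herm_form e0 (t *s z) = (cmod t)\<^sup>2 * herm_form e0 z"
  by (simp add: herm_form_def norm_mult power_mult_distrib sum_distrib_left algebra_simps)

lemma scale_mem_Dn1_iff: "t \<noteq> 0 \<Longrightarrow> t *s z \<in> Dn1 e0 \<longleftrightarrow> z \<in> Dn1 e0"
  by (simp add: Dn1_eq herm_form_scale zero_less_mult_iff)

lemma norm_component_le_if_not_mem_Dn1:
  assumes "z \<notin> Dn1 e0"
  shows "cmod (z $ i) \<le> cmod (z $ e0)"
  using assms mem_Dn1_if_component_gt [of i e0 z] by (cases "i = e0") force+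

lemma eq_0_if_not_mem_Dn1:
  assumes "z \<notin> Dn1 e0" "z $ e0 = 0"
  shows "z = 0"
  using norm_component_le_if_not_mem_Dn1 [OF assms(1)] assms(2) by (simp add: vec_eq_iff)

lemma zero_not_mem_Dn1 [simp]: "0 \<notin> Dn1 e0"
  by (simp add: Dn1_def)

lemma axis_not_mem_Dn1: "axis e0 1 \<notin> Dn1 e0"
  by (auto simp: Dn1_def axis_def sum.neutral)

section \<open>Entire maps preserving the cone\<close>

lemma hol_curve_compose:
  assumes "\<And>j. curve_holomorphic UNIV (\<lambda>z. F z $ j)" "open U" "hol_curve U c"
  shows "hol_curve U (\<lambda>t. F (c t))"
  unfolding hol_curve_def using curve_holomorphicD [OF assms(1)] assms(2,3) by blast

lemma curve_holomorphic_compose: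
  assumes "\<And>j. curve_holomorphic UNIV (\<lambda>z. G z $ j)" "curve_holomorphic UNIV h"
  shows "curve_holomorphic UNIV (\<lambda>z. h (G z))"
  unfolding curve_holomorphic_def
  using curve_holomorphicD [OF assms(2)] hol_curve_compose [of G, OF assms(1)] by blast

lemma curve_holomorphic_component: "curve_holomorphic UNIV (\<lambda>z. z $ j)"
  by (auto simp: curve_holomorphic_def hol_curve_def)

lemma curve_holomorphic_scale: "curve_holomorphic UNIV (\<lambda>z. (t *s z) $ j)"
  by (auto simp: curve_holomorphic_def hol_curve_def intro!: holomorphic_intros)

text \<open>Outside \<open>Dn1\<close> every component is dominated by component \<open>e0\<close>,
  which vanishes only where the whole vector does, and so at most once along the line by
  injectivity. All components are therefore constant multiples of component
  \<open>e0\<close>.\<close>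

lemma entire_image_of_line:
  fixes F :: "complex^'n::finite \<Rightarrow> complex^'n"
  assumes hol: "\<And>j. curve_holomorphic UNIV (\<lambda>z. F z $ j)" and inj: "inj F"
    and F: "\<And>z. z \<notin> Dn1 e0 \<Longrightarrow> F z \<notin> Dn1 e0" and z: "z \<notin> Dn1 e0" "z \<noteq> 0"
  shows "\<exists>u \<psi>. \<psi> holomorphic_on UNIV \<and> u \<notin> Dn1 e0 \<and> u \<noteq> 0 \<and> (\<forall>t. F (t *s z) = \<psi> t *s u)"
proof -
  define \<psi> where "\<psi> t = F (t *s z) $ e0" for t
  have line: "t *s z \<notin> Dn1 e0" for t
    using z scale_mem_Dn1_iff [of t z e0] by (cases "t = 0") auto
  have holc: "(\<lambda>t. F (t *s z) $ j) holomorphic_on UNIV" for j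
    using hol_curve_compose [of F UNIV, OF hol _ hol_curve_scale] by (simp add: hol_curve_def)
  have inj_line: "s = t" if "F (s *s z) = F (t *s z)" for s t
    using injD [OF inj that] z(2) by simp
  \<comment> \<open>The unique zero along the line if there is one, an arbitrary number
    otherwise.\<close>
  define t0 where "t0 = (SOME t. F (t *s z) = 0)"
  have zero: "t = t0" if "\<psi> t = 0" for t
  proof -
    have t: "F (t *s z) = 0"
      using eq_0_if_not_mem_Dn1 [OF F [OF line]] that by (simp add: \<psi>_def)
    then have "F (t0 *s z) = 0"
      unfolding t0_def by (rule someI)
    then show ?thesis
      using inj_line t by simp
  qed
  have "\<exists>c. \<forall>t. F (t *s z) $ j = c * \<psi> t" for j
    using holc norm_component_le_if_not_mem_Dn1 [OF F [OF line]] zero unfolding \<psi>_def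
    by (intro entire_norm_le_imp_proportional) auto
  then obtain c where c: "\<And>j t. F (t *s z) $ j = c j * \<psi> t"
    by metis
  define u where "u = (\<chi> j. c j)"
  have Fu: "F (t *s z) = \<psi> t *s u" for t
    by (simp add: vec_eq_iff u_def c)
  have ne: "F (0 *s z) \<noteq> F (1 *s z)"
    using inj_line [of 0 1] by auto
  then have "u \<noteq> 0"
    unfolding Fu by auto
  moreover obtain t where "\<psi> t \<noteq> 0"
    using ne unfolding Fu by (metis vector_smult_lzero)
  then have "u \<notin> Dn1 e0"
    using F [OF line [of t]] scale_mem_Dn1_iff [of "\<psi> t" u e0] by (simp add: Fu)
  moreover have "\<psi> holomorphic_on UNIV"
    unfolding \<psi>_def by (rule holc)
  ultimately show ?thesis
    using Fu by blast
qed

context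
  fixes e0 e1 :: "'n::finite" and F G :: "complex^'n \<Rightarrow> complex^'n"
  assumes e: "e1 \<noteq> e0"
    and holF: "\<And>j. curve_holomorphic UNIV (\<lambda>z. F z $ j)"
    and holG: "\<And>j. curve_holomorphic UNIV (\<lambda>z. G z $ j)"
    and GF: "\<And>z. G (F z) = z" and FG: "\<And>z. F (G z) = z"
    and FD: "\<And>z. F z \<in> Dn1 e0 \<longleftrightarrow> z \<in> Dn1 e0"
begin

text \<open>\<open>F\<close> sends the line of \<open>z\<close> into a line spanned by some
  \<open>u\<close>, and \<open>G\<close> sends the line of \<open>u\<close> into one spanned by some
  \<open>v\<close>. Since \<open>G\<close> undoes \<open>F\<close>, \<open>v\<close> is proportional
  to \<open>z\<close>, and the two parameter changes are inverse up to a rescaling.\<close>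

lemma line_automorphism:
  assumes z: "z \<notin> Dn1 e0" "z \<noteq> 0"
  shows "\<exists>u \<psi> \<theta>. \<psi> holomorphic_on UNIV \<and> \<theta> holomorphic_on UNIV \<and> u \<noteq> 0 \<and>
    (\<forall>t. F (t *s z) = \<psi> t *s u) \<and> (\<forall>t. \<theta> (\<psi> t) = t) \<and> (\<forall>t. \<psi> (\<theta> t) = t)"
proof -
  have inj: "inj F" "inj G"
    using GF FG by (metis injI)+
  have GD: "G z \<notin> Dn1 e0" if "z \<notin> Dn1 e0" for z
    using FD [of "G z"] FG that by simp
  obtain u \<psi> where u: "\<psi> holomorphic_on UNIV" "u \<notin> Dn1 e0" "u \<noteq> 0" "\<And>t. F (t *s z) = \<psi> t *s u"
    using entire_image_of_line [of F, OF holF inj(1) _ z] FD by blast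
  obtain v \<theta> where v: "\<theta> holomorphic_on UNIV" "\<And>t. G (t *s u) = \<theta> t *s v"
    using entire_image_of_line [of G, OF holG inj(2) GD u(2,3)] by blast
  \<comment> \<open>The factor relating \<open>v\<close> to \<open>z\<close>, read off from G (F z)
    = z.\<close>
  define k where "k = \<theta> (\<psi> 1)"
  have kv: "z = k *s v"
    using GF [of "1 *s z"] unfolding u(4) v(2) k_def by simp
  then have k: "k \<noteq> 0"
    using z(2) by auto
  have G: "G (t *s u) = (\<theta> t / k) *s z" for t
    using k by (simp add: v(2) kv)
  have "\<theta> (\<psi> t) / k = t" for t
    using GF [of "t *s z"] z(2) unfolding u(4) G by simp
  moreover have "\<psi> (\<theta> t / k) = t" for t
    using FG [of "t *s u"] u(3) unfolding G u(4) by simp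
  moreover have "(\<lambda>t. \<theta> t / k) holomorphic_on UNIV"
    using v(1) k by (intro holomorphic_intros) auto
  ultimately show ?thesis
    using u by blast
qed

text \<open>Every line through 0 in the cone is mapped onto a line through 0, so it contains G 0.
  Two distinct such lines meet only in 0.\<close>

lemma fixes_0: "F 0 = 0"
proof -
  have mult: "\<exists>t. G 0 = t *s z" if "z \<notin> Dn1 e0" "z \<noteq> 0" for z
  proof -
    obtain u \<psi> \<theta> where "\<And>t. F (t *s z) = \<psi> t *s u" "\<And>t. \<psi> (\<theta> t) = (t::complex)"
      using line_automorphism [OF \<open>z \<notin> Dn1 e0\<close> \<open>z \<noteq> 0\<close>] by metis
    then have "F (\<theta> 0 *s z) = 0"
      by simp
    then have "G 0 = \<theta> 0 *s z"
      using GF by metis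
    then show ?thesis ..
  qed
  \<comment> \<open>A null vector of the form, which lies outside \<open>Dn1\<close> because the
    defining inequality is strict.\<close>
  have "axis e0 1 + axis e1 1 \<notin> Dn1 e0"
  proof -
    have "(\<Sum>i\<in>UNIV - {e0}. (cmod ((axis e0 1 + axis e1 1 :: complex^'n) $ i))\<^sup>2)
        = (\<Sum>i\<in>UNIV - {e0}. if i = e1 then 1 else 0)"
      by (intro sum.cong) (auto simp: axis_def)
    then show ?thesis
      using e by (simp add: Dn1_def axis_def)
  qed
  moreover have nz: "axis e0 1 + axis e1 1 \<noteq> (0 :: complex^'n)"
    using e by (auto simp: vec_eq_iff axis_def dest: spec [of _ e0])
  ultimately obtain s where s: "G 0 = s *s (axis e0 1 + axis e1 1)"
    using mult by blast
  obtain t where t: "G 0 = t *s axis e0 1"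
    using mult axis_not_mem_Dn1 by (metis axis_eq_0_iff zero_neq_one)
  have "s = 0"
    using arg_cong [OF s, of "\<lambda>x. x $ e1"] arg_cong [OF t, of "\<lambda>x. x $ e1"] e
    by (simp add: axis_def)
  then show ?thesis
    using s FG [of 0] by simp
qed

text \<open>On the cone the parameter change is an entire automorphism fixing 0, hence linear. The
  identity spreads from the open set of negative vectors to the whole space.\<close>

lemma homogeneous: "F (t *s z) = t *s F z"
proof -
  have cone: "F (t *s z) = t *s F z" if z: "z \<notin> Dn1 e0" for z
  proof (cases "z = 0")
    case False
    obtain u \<psi> \<theta> where u: "\<psi> holomorphic_on UNIV" "\<theta> holomorphic_on UNIV" "u \<noteq> 0"
      "\<And>t. F (t *s z) = \<psi> t *s u" "\<And>t. \<theta> (\<psi> t) = t"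
      using line_automorphism [OF z False] by metis
    have "\<psi> 0 = 0"
      using u(3) u(4) [of 0] fixes_0 by simp
    then have "\<psi> t = t * \<psi> 1"
      using u by (intro entire_automorphism_fixing_0_linear [of _ \<theta>]) auto
    then show ?thesis
      using u(4) [of t] u(4) [of 1] by simp
  qed (simp add: fixes_0)
  have "F (t *s z) $ j = (t *s F z) $ j" for j
  proof (rule curve_holomorphic_eq_on_convex
      [of UNIV "\<lambda>z. F (t *s z) $ j" "\<lambda>z. (t *s F z) $ j"])
    show "curve_holomorphic UNIV (\<lambda>z. F (t *s z) $ j)"
      by (intro curve_holomorphic_compose [OF curve_holomorphic_scale] holF)
    show "curve_holomorphic UNIV (\<lambda>z. (t *s F z) $ j)"
      by (intro curve_holomorphic_compose [OF holF] curve_holomorphic_scale)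
    show "open {z. herm_form e0 z < 0}"
      by (intro open_Collect_less continuous_intros)
    show "axis e0 1 \<in> {z. herm_form e0 z < 0}"
      by (simp add: herm_form_def axis_def)
    show "F (t *s z) $ j = (t *s F z) $ j" if "z \<in> {z. herm_form e0 z < 0}" for z
      using cone [of z] that by (simp add: Dn1_eq)
  qed auto
  then show ?thesis
    by (simp add: vec_eq_iff)
qed

text \<open>By homogeneity F (v + s z) = s F (z + v / s), so the growth in \<open>s\<close> is at
  most linear and Liouville's theorem for polynomials applies.\<close>

lemma affine_on_lines: "\<exists>b. \<forall>s. F (v + s *s z) $ j = F v $ j + s * b"
proof -
  define q where "q s = F (v + s *s z) $ j" for s
  define p where "p s = F (z + s *s v) $ j" for s
  have hol: "q holomorphic_on UNIV" "p holomorphic_on UNIV"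
    unfolding p_def q_def by (intro curve_holomorphicD [OF holF]; simp)+
  have "compact (p ` cball 0 1)"
    using hol(2) by (intro compact_continuous_image)
      (auto intro: holomorphic_on_imp_continuous_on holomorphic_on_subset)
  then obtain M where M: "\<And>x. x \<in> p ` cball 0 1 \<Longrightarrow> norm x \<le> M"
    using compact_imp_bounded bounded_iff by metis
  have "norm (q s) \<le> M * norm s ^ 1" if s: "1 \<le> norm s" for s
  proof -
    have "s \<noteq> 0"
      using s by auto
    then have "v + s *s z = s *s (z + inverse s *s v)"
      by (simp add: vec_eq_iff algebra_simps)
    then have "q s = (s *s F (z + inverse s *s v)) $ j"
      unfolding q_def homogeneous [symmetric] by (simp only:)
    then have "q s = s * p (inverse s)"
      by (simp add: p_def)
    moreover have "norm (p (inverse s)) \<le> M"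
      using s by (intro M imageI) (simp add: norm_inverse inverse_le_1_iff)
    ultimately show ?thesis
      by (simp add: norm_mult mult.commute [of M] mult_left_mono)
  qed
  then have "q s = (\<Sum>k\<le>1. (deriv ^^ k) q 0 / fact k * s ^ k)" for s
    by (rule Liouville_polynomial [OF hol(1)])
  then have "q s = F v $ j + s * deriv q 0" for s
    by (simp add: q_def)
  then show ?thesis
    unfolding q_def by blast
qed

text \<open>The affine expansions along v + s z and z + s v describe the same vector at s = 1 and
  opposite vectors at s = -1; these two equations determine the slope.\<close>

lemma additive: "F (z + v) = F z + F v"
proof -
  have "F (z + v) $ j = F z $ j + F v $ j" for j
  proof -
    obtain b where b: "\<And>s. F (v + s *s z) $ j = F v $ j + s * b"
      using affine_on_lines by metis
    obtain a where a: "\<And>s. F (z + s *s v) $ j = F z $ j + s * a"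
      using affine_on_lines by metis
    have "F (v - z) = - F (z - v)"
      using homogeneous [of "-1" "z - v"] by (simp add: vector_sneg_minus1 [symmetric])
    then have "F v $ j - b = - (F z $ j - a)"
      using b [of "-1"] a [of "-1"] by (simp add: vector_sneg_minus1 [symmetric])
    moreover have "F v $ j + b = F z $ j + a"
      using b [of 1] a [of 1] by (simp add: add.commute)
    ultimately have "a = F v $ j"
      by algebra
    then show ?thesis
      using a [of 1] by simp
  qed
  then show ?thesis
    by (simp add: vec_eq_iff)
qed

end

lemma obtain_two_other_indices:
  fixes e0 :: "'n::finite"
  assumes "CARD('n) \<ge> 3"
  obtains e1 e2 where "e1 \<noteq> e0" "e2 \<noteq> e0" "e2 \<noteq> e1"
proof -
  have "\<not> UNIV \<subseteq> {e0}"
    using assms card_mono [of "{e0}" UNIV] by fastforce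
  then obtain e1 where e1: "e1 \<noteq> e0"
    by blast
  have "\<not> UNIV \<subseteq> {e0, e1}"
    using assms card_mono [of "{e0, e1}" UNIV] e1 by fastforce
  then show ?thesis
    using that e1 by blast
qed

text \<open>Both \<open>f\<close> and its inverse extend to entire maps; the extensions remain
  mutually inverse by the identity theorem, and the preceding results on cone-preserving maps
  apply.\<close>

lemma Aut_Dn1_linear:
  fixes e0 :: "'n::finite"
  assumes card: "CARD('n) \<ge> 3" and f: "f \<in> Aut (Dn1 e0)"
  shows "\<exists>F. (\<forall>t z. F (t *s z) = t *s F z) \<and> (\<forall>z w. F (z + w) = F z + F w) \<and>
    (\<forall>z. F z \<in> Dn1 e0 \<longleftrightarrow> z \<in> Dn1 e0) \<and> (\<forall>z\<in>Dn1 e0. F z = f z)"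
proof -
  let ?D = "Dn1 e0"
  obtain e1 e2 where e1: "e1 \<noteq> e0" and e2: "e2 \<noteq> e0" "e2 \<noteq> e1"
    using obtain_two_other_indices [OF card] .
  let ?g = "aut_inv ?D f"
  have bij: "bij_betw f ?D ?D" and holo: "holo_on ?D f" "holo_on ?D ?g"
    using f by (auto simp: Aut_def)
  have ext: "\<exists>F. (\<forall>j. curve_holomorphic UNIV (\<lambda>z. F z $ j)) \<and> (\<forall>z\<in>?D. F z = f z)"
    if hf: "holo_on ?D f" for f
  proof -
    have "\<exists>H. curve_holomorphic UNIV H \<and> (\<forall>z\<in>?D. H z = f z $ j)" for j
      using hf e1 e2
      by (intro hartogs_extension [of e1 e0 e2] holo_on_imp_curve_holomorphic)
        (auto intro!: continuous_intros holo_on_imp_continuous_on)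
    then obtain H where "\<And>j. curve_holomorphic UNIV (H j)" "\<And>j z. z \<in> ?D \<Longrightarrow> H j z = f z $ j"
      by metis
    then show ?thesis
      by (intro exI [of _ "\<lambda>z. \<chi> j. H j z"]) (auto simp: vec_eq_iff)
  qed
  obtain F where F: "\<And>j. curve_holomorphic UNIV (\<lambda>z. F z $ j)" "\<And>z. z \<in> ?D \<Longrightarrow> F z = f z"
    using ext [OF holo(1)] by blast
  obtain G where G: "\<And>j. curve_holomorphic UNIV (\<lambda>z. G z $ j)" "\<And>z. z \<in> ?D \<Longrightarrow> G z = ?g z"
    using ext [OF holo(2)] by blast
  have maps: "f z \<in> ?D" "?g z \<in> ?D" "?g (f z) = z" "f (?g z) = z" if "z \<in> ?D" for z
    using bij that bij_betw_inv_into_left [OF bij] bij_betw_inv_into_right [OF bij]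
      bij_betw_apply [OF bij] bij_betw_apply [OF bij_betw_inv_into [OF bij]]
    by (auto simp: aut_inv_def)
  have id: "H (K z) = z"
    if "\<And>j. curve_holomorphic UNIV (\<lambda>z. H z $ j)" "\<And>j. curve_holomorphic UNIV (\<lambda>z. K z $ j)"
      "\<And>z. z \<in> ?D \<Longrightarrow> H (K z) = z" for H K :: "complex^'n \<Rightarrow> complex^'n" and z
  proof -
    have "H (K z) $ j = z $ j" for j
    proof (rule curve_holomorphic_eq_on_convex [of UNIV "\<lambda>z. H (K z) $ j" "\<lambda>z. z $ j"])
      show "curve_holomorphic UNIV (\<lambda>z. H (K z) $ j)"
        by (rule curve_holomorphic_compose [OF that(2,1)])
      show "axis e1 1 \<in> ?D"
        using e1 by (intro mem_Dn1_if_component_gt [of e1]) (auto simp: axis_def)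
    qed (auto simp: that(3) open_Dn1 curve_holomorphic_component)
    then show ?thesis
      by (simp add: vec_eq_iff)
  qed
  have GF: "G (F z) = z" and FG: "F (G z) = z" for z
    using id [of G F] id [of F G] F G maps by auto
  have FD: "F z \<in> ?D \<longleftrightarrow> z \<in> ?D" for z
  proof
    assume "F z \<in> ?D"
    then have "G (F z) \<in> ?D"
      using G(2) maps(2) by simp
    then show "z \<in> ?D"
      by (simp only: GF)
  qed (simp add: F(2) maps(1))
  note props = e1 F(1) G(1) GF FG FD
  show ?thesis
    using homogeneous [of e1 e0 F G, OF props] additive [of e1 e0 F G, OF props] FD F(2) by blast
qed

section \<open>Linear maps preserving Dn1\<close>

text \<open>The real symmetric bilinear form polarising \<open>herm_form\<close>: the real inner
  product with the sign of coordinate \<open>e0\<close> reversed, whence the factor 2.\<close>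

definition polar_form :: "'n::finite \<Rightarrow> complex^'n \<Rightarrow> complex^'n \<Rightarrow> real" where
  "polar_form e0 x y = x \<bullet> y - 2 * (x $ e0 \<bullet> y $ e0)"

lemma herm_form_eq_polar_form: "herm_form e0 z = polar_form e0 z z"
proof -
  have "z \<bullet> z = (\<Sum>i\<in>UNIV. (cmod (z $ i))\<^sup>2)"
    by (simp add: inner_vec_def power2_norm_eq_inner)
  also have "\<dots> = (cmod (z $ e0))\<^sup>2 + (\<Sum>i\<in>UNIV - {e0}. (cmod (z $ i))\<^sup>2)"
    by (rule sum.remove) auto
  finally show ?thesis
    by (simp add: herm_form_def polar_form_def power2_norm_eq_inner)
qed

lemma herm_form_eq_norm: "herm_form e0 z = (norm z)\<^sup>2 - 2 * (cmod (z $ e0))\<^sup>2"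
  by (simp add: herm_form_eq_polar_form polar_form_def power2_norm_eq_inner)

lemma herm_form_add:
  "herm_form e0 (x + y) = herm_form e0 x + herm_form e0 y + 2 * polar_form e0 x y"
  by (simp add: herm_form_eq_polar_form polar_form_def inner_add_left inner_add_right
      inner_commute algebra_simps)

lemma polar_form_scaleR: "polar_form e0 x (r *\<^sub>R y) = r * polar_form e0 x y"
  by (simp add: polar_form_def algebra_simps)

lemma scaleR_eq_scale: "r *\<^sub>R z = complex_of_real r *s (z :: complex^'n::finite)"
  unfolding vec_eq_iff vector_scaleR_component vector_smult_component
  by (simp add: scaleR_conv_of_real)

text \<open>\<open>F\<close> maps null vectors to null vectors. Comparing x + \<alpha> u with x -
  \<alpha> u, both null when |\<alpha>| = |x|, separates the diagonal terms of the pulled-back form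
  from the cross term, and shows that it is a multiple of the original.\<close>

lemma linear_preserving_Dn1_conformal:
  fixes e0 :: "'n::finite"
  assumes scale: "\<And>t z. F (t *s z) = t *s F z" and add: "\<And>z w. F (z + w) = F z + F w"
    and FD: "\<And>z. F z \<in> Dn1 e0 \<longleftrightarrow> z \<in> Dn1 e0"
  shows "\<exists>\<mu>. \<forall>z. herm_form e0 (F z) = \<mu> * herm_form e0 z"
proof -
  let ?q = "herm_form e0" and ?B = "polar_form e0"
  define u :: "complex^'n" where "u = axis e0 1"
  define Q where "Q z = ?q (F z)" for z
  have F0: "F 0 = 0"
    using scale [of 0 0] by simp
  have FR: "F (r *\<^sub>R z) = r *\<^sub>R F z" for r z
    by (simp add: scaleR_eq_scale scale)
  have pos: "0 < Q z \<longleftrightarrow> 0 < ?q z" for z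
    using FD [of z] by (simp add: Dn1_eq Q_def)
  have Q_scale: "Q (t *s z) = (cmod t)\<^sup>2 * Q z" for t z
    by (simp add: Q_def scale herm_form_scale)
  have Q_add: "Q (x + y) = Q x + Q y + 2 * ?B (F x) (F y)" for x y
    by (simp add: Q_def add herm_form_add)
  have q_split: "?q (x + \<alpha> *s u) = (norm x)\<^sup>2 - (cmod \<alpha>)\<^sup>2" if "x $ e0 = 0" for x \<alpha>
  proof -
    have "?q (x + \<alpha> *s u) = (\<Sum>i\<in>UNIV - {e0}. (cmod (x $ i))\<^sup>2) - (cmod \<alpha>)\<^sup>2"
      unfolding herm_form_def using that by (auto simp: u_def axis_def intro!: sum.cong)
    moreover have "(\<Sum>i\<in>UNIV - {e0}. (cmod (x $ i))\<^sup>2) = (norm x)\<^sup>2"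
      using herm_form_eq_norm [of e0 x] that by (simp add: herm_form_def)
    ultimately show ?thesis
      by simp
  qed
  \<comment> \<open>A null vector lies outside \<open>Dn1\<close>, so \<open>Q\<close> is at most 0
    on it; enlarging \<open>x\<close> by a factor 1 + \<epsilon> moves it into \<open>Dn1\<close>,
    so in the limit \<open>Q\<close> is also at least 0.\<close>
  have null: "Q (x + \<alpha> *s u) = 0" if x: "x $ e0 = 0" and \<alpha>: "cmod \<alpha> = norm x" for x \<alpha>
  proof (cases "x = 0")
    case True
    then show ?thesis
      using \<alpha> F0 by (simp add: Q_def herm_form_def)
  next
    case False
    let ?z = "x + \<alpha> *s u"
    have "?q ?z = 0"
      by (simp add: q_split [OF x] \<alpha>)
    then have le: "Q ?z \<le> 0"
      using pos [of ?z] by simp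
    have "0 \<le> ?q (F ?z + \<epsilon> *\<^sub>R F x)" if \<epsilon>: "0 < \<epsilon>" for \<epsilon>
    proof -
      have "?z + \<epsilon> *\<^sub>R x = (1 + \<epsilon>) *\<^sub>R x + \<alpha> *s u"
        by (simp add: algebra_simps)
      then have "?q (?z + \<epsilon> *\<^sub>R x) = (norm ((1 + \<epsilon>) *\<^sub>R x))\<^sup>2 - (norm x)\<^sup>2"
        using x by (simp only:) (subst q_split, auto simp: \<alpha>)
      also have "\<dots> > 0"
      proof -
        have "norm x < norm ((1 + \<epsilon>) *\<^sub>R x)"
          using False \<epsilon> by simp
        then show ?thesis
          by (simp add: power_strict_mono)
      qed
      finally have "0 < Q (?z + \<epsilon> *\<^sub>R x)"
        by (simp add: pos)
      then show ?thesis
        by (simp add: Q_def add FR)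
    qed
    then have ev: "\<forall>\<^sub>F \<epsilon> in at_right 0. 0 \<le> ?q (F ?z + \<epsilon> *\<^sub>R F x)"
      by (auto simp: eventually_at_filter)
    have "continuous_on {0..} (\<lambda>\<epsilon>::real. ?q (F ?z + \<epsilon> *\<^sub>R F x))"
      by (rule continuous_on_compose2 [OF continuous_on_herm_form [of UNIV]])
        (auto intro!: continuous_intros)
    then have "((\<lambda>\<epsilon>. ?q (F ?z + \<epsilon> *\<^sub>R F x)) \<longlongrightarrow> ?q (F ?z + 0 *\<^sub>R F x)) (at 0 within {0..})"
      unfolding continuous_on_def by (rule bspec) simp
    then have "((\<lambda>\<epsilon>. ?q (F ?z + \<epsilon> *\<^sub>R F x)) \<longlongrightarrow> ?q (F ?z + 0 *\<^sub>R F x)) (at_right 0)"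
      by (rule tendsto_within_subset) auto
    then have "0 \<le> ?q (F ?z + 0 *\<^sub>R F x)"
      using ev by (rule tendsto_lowerbound) simp
    then show ?thesis
      using le by (simp add: Q_def)
  qed
  \<comment> \<open>The form takes the value -1 at \<open>u\<close>.\<close>
  define \<mu> where "\<mu> = - Q u"
  have Qx: "Q x = \<mu> * (norm x)\<^sup>2" and Bx: "cmod \<alpha> = norm x \<Longrightarrow> ?B (F x) (F (\<alpha> *s u)) = 0"
    if x: "x $ e0 = 0" for x \<alpha>
  proof -
    have *: "Q x = \<mu> * (norm x)\<^sup>2 \<and> ?B (F x) (F (\<alpha> *s u)) = 0" if \<alpha>: "cmod \<alpha> = norm x" for \<alpha>
    proof -
      have "?B (F x) (F ((- \<alpha>) *s u)) = - ?B (F x) (F (\<alpha> *s u))"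
        using polar_form_scaleR [of e0 "F x" "-1" "F (\<alpha> *s u)"] FR [of "-1" "\<alpha> *s u"]
        by simp
      moreover have "Q (\<alpha> *s u) = - \<mu> * (norm x)\<^sup>2" "Q ((- \<alpha>) *s u) = - \<mu> * (norm x)\<^sup>2"
        unfolding Q_scale by (simp_all add: \<alpha> \<mu>_def)
      ultimately show ?thesis
        using null [OF x, of \<alpha>] null [OF x, of "- \<alpha>"] \<alpha> unfolding Q_add by simp
    qed
    show "Q x = \<mu> * (norm x)\<^sup>2"
      using * [of "of_real (norm x)"] by simp
    show "?B (F x) (F (\<alpha> *s u)) = 0" if "cmod \<alpha> = norm x"
      using * [OF that] by simp
  qed
  have "?q (F z) = \<mu> * ?q z" for z
  proof -
    define x where "x = vec_upd z e0 0"
    define \<beta> where "\<beta> = z $ e0"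
    have x: "x $ e0 = 0"
      by (simp add: x_def)
    have z: "z = x + \<beta> *s u"
      by (simp add: vec_eq_iff x_def \<beta>_def u_def axis_def)
    \<comment> \<open>The cross term is real-linear in its second argument, so \<beta> can be
      rescaled to have modulus |x|.\<close>
    have "?B (F x) (F (\<beta> *s u)) = 0"
    proof (cases "\<beta> = 0")
      case True
      then show ?thesis
        by (simp add: F0 polar_form_def)
    next
      case False
      define r where "r = norm x / cmod \<beta>"
      have "?B (F x) (F ((of_real r * \<beta>) *s u)) = 0"
      proof (rule Bx [OF x])
        show "cmod (of_real r * \<beta>) = norm x"
          unfolding norm_mult norm_of_real using False by (simp add: r_def)
      qed
      moreover have "(of_real r * \<beta>) *s u = r *\<^sub>R (\<beta> *s u)"
        by (simp add: scaleR_eq_scale)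
      ultimately have "r * ?B (F x) (F (\<beta> *s u)) = 0"
        by (simp only: FR polar_form_scaleR)
      moreover have "?B (F x) (F (\<beta> *s u)) = 0" if "x = 0"
        by (simp add: that F0 polar_form_def)
      ultimately show ?thesis
        using False by (auto simp: r_def)
    qed
    then have "Q z = \<mu> * (norm x)\<^sup>2 + (cmod \<beta>)\<^sup>2 * Q u"
      by (simp add: z Q_add Q_scale Qx [OF x])
    also have "\<dots> = \<mu> * ?q z"
      by (simp add: z q_split [OF x] \<mu>_def algebra_simps)
    finally show ?thesis
      by (simp add: Q_def)
  qed
  then show ?thesis
    by blast
qed

text \<open>The Calabi--Markus argument: two hyperplanes meet in codimension at most 2, and the ambient
  dimension is at least 3.\<close>

lemma hyperplane_meets_image:
  fixes F :: "complex^'n::finite \<Rightarrow> complex^'n"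
  assumes e: "e1 \<noteq> e0" "e2 \<noteq> e0" "e2 \<noteq> e1"
    and scale: "\<And>t z. F (t *s z) = t *s F z" and add: "\<And>z w. F (z + w) = F z + F w"
  shows "\<exists>w. norm w = 1 \<and> w $ e0 = 0 \<and> F w $ e0 = 0"
proof -
  define a where "a = F (axis e1 1) $ e0"
  define b where "b = F (axis e2 1) $ e0"
  have comb: "F (s *s axis e1 1 + t *s axis e2 1) $ e0 = s * a + t * b" for s t
    by (simp add: add scale a_def b_def)
  have comp: "(s *s axis e1 1 + t *s axis e2 1) $ e0 = 0"
      "(s *s axis e1 1 + t *s axis e2 1) $ e1 = s"
      "(s *s axis e1 1 + t *s axis e2 1) $ e2 = t" for s t :: complex
    using e by (auto simp: axis_def)
  \<comment> \<open>A linear functional on the plane spanned by the axes \<open>e1\<close> and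
    \<open>e2\<close> has a nontrivial kernel.\<close>
  obtain s t where st: "s * a + t * b = 0" "s \<noteq> 0 \<or> t \<noteq> 0"
  proof (cases "a = 0")
    case True
    then show ?thesis
      using that [of 1 0] by simp
  next
    case False
    then show ?thesis
      using that [of "- b" a] by simp
  qed
  define v where "v = s *s axis e1 1 + t *s (axis e2 1 :: complex^'n)"
  have "v $ e1 = s" "v $ e2 = t"
    using comp(2,3) by (simp_all only: v_def)
  then have "v \<noteq> 0"
    using st(2) by auto
  moreover have "v $ e0 = 0" "F v $ e0 = 0"
    using comb comp(1) st(1) by (simp_all only: v_def)
  moreover have "F (sgn v) = of_real (inverse (norm v)) *s F v"
    by (simp only: sgn_div_norm scaleR_eq_scale scale)
  ultimately show ?thesis
    by (intro exI [of _ "sgn v"]) (simp add: norm_sgn, simp add: sgn_div_norm)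
qed

section \<open>Properly discontinuous groups\<close>

text \<open>The unit vector \<open>w\<close> found for the linear extension has form value 1, so it
  lies in \<open>Dn1\<close>, where the extension agrees with \<open>f\<close>.\<close>

lemma Aut_Dn1_conformal:
  fixes e0 :: "'n::finite"
  assumes card: "CARD('n) \<ge> 3" and f: "f \<in> Aut (Dn1 e0)"
  obtains \<mu> w where "\<And>z. z \<in> Dn1 e0 \<Longrightarrow> herm_form e0 (f z) = \<mu> * herm_form e0 z"
    "norm w = 1" "w $ e0 = 0" "f w $ e0 = 0"
proof -
  obtain e1 e2 where e: "e1 \<noteq> e0" "e2 \<noteq> e0" "e2 \<noteq> e1"
    using obtain_two_other_indices [OF card] .
  obtain F where F: "\<And>t z. F (t *s z) = t *s F z" "\<And>z w. F (z + w) = F z + F w"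
    "\<And>z. F z \<in> Dn1 e0 \<longleftrightarrow> z \<in> Dn1 e0" "\<And>z. z \<in> Dn1 e0 \<Longrightarrow> F z = f z"
    using Aut_Dn1_linear [OF assms] by metis
  obtain \<mu> where \<mu>: "\<And>z. herm_form e0 (F z) = \<mu> * herm_form e0 z"
    using linear_preserving_Dn1_conformal [OF F(1-3)] by metis
  obtain w where w: "norm w = 1" "w $ e0 = 0" "F w $ e0 = 0"
    using hyperplane_meets_image [OF e F(1,2)] by blast
  have "w \<in> Dn1 e0"
    by (simp add: Dn1_eq herm_form_eq_norm w)
  then show ?thesis
    using that [of \<mu> w] \<mu> w F(4) by metis
qed

text \<open>The condition on \<open>g\<close> confines its conformal factor \<mu> to the interval
  from 1/b to 1/a. Then the unit vector \<open>w\<close> and its image, of squared norm \<mu>, both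
  lie in one compact shell of the positive definite hyperplane, and proper discontinuity applies to
  that shell.\<close>

lemma finite_conformal_factor_bounded:
  fixes e0 :: "'n::finite"
  assumes card: "CARD('n) \<ge> 3" and \<Gamma>: "\<Gamma> \<subseteq> Aut (Dn1 e0)"
    and pd: "properly_discontinuous (Dn1 e0) \<Gamma>" and a: "0 < a"
  shows "finite {g \<in> \<Gamma>. \<exists>z. a \<le> herm_form e0 z \<and> herm_form e0 z \<le> b \<and> herm_form e0 (g z) = 1}"
    (is "finite ?T")
proof (cases "a \<le> b")
  case True
  then have b: "0 < b"
    using a by simp
  \<comment> \<open>The shell must contain squared norm 1 for \<open>w\<close> and every possible
    \<mu> for its image.\<close>
  define l u where "l = min 1 (1 / b)" and "u = max 1 (1 / a)"
  define K where "K = {z :: complex^'n. z $ e0 = 0 \<and> l \<le> (norm z)\<^sup>2 \<and> (norm z)\<^sup>2 \<le> u}"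
  have l: "0 < l"
    using b by (simp add: l_def)
  have "closed K"
    unfolding K_def
    by (intro closed_Collect_conj closed_Collect_eq closed_Collect_le continuous_intros)
  moreover have "bounded K"
    unfolding bounded_iff K_def by (auto intro!: exI [of _ "sqrt u"] real_le_rsqrt)
  ultimately have "compact K"
    by (simp add: compact_eq_bounded_closed)
  moreover have "K \<subseteq> Dn1 e0"
    using l by (auto simp: K_def Dn1_eq herm_form_eq_norm)
  ultimately have "finite {g \<in> \<Gamma>. g ` K \<inter> K \<noteq> {}}"
    using pd by (simp add: properly_discontinuous_def)
  moreover have "g ` K \<inter> K \<noteq> {}" if g: "g \<in> ?T" for g
  proof -
    obtain z where z: "a \<le> herm_form e0 z" "herm_form e0 z \<le> b" "herm_form e0 (g z) = 1"
      and "g \<in> Aut (Dn1 e0)"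
      using g \<Gamma> by blast
    then obtain \<mu> w where \<mu>: "\<And>z. z \<in> Dn1 e0 \<Longrightarrow> herm_form e0 (g z) = \<mu> * herm_form e0 z"
      and w: "norm w = 1" "w $ e0 = 0" "g w $ e0 = 0"
      using Aut_Dn1_conformal [OF card] by metis
    have "\<mu> = 1 / herm_form e0 z"
      using \<mu> [of z] z a by (simp add: Dn1_eq field_simps)
    then have "l \<le> \<mu>" "\<mu> \<le> u"
      using z a b by (auto simp: l_def u_def min_le_iff_disj le_max_iff_disj intro: divide_left_mono frac_le)
    moreover have "(norm (g w))\<^sup>2 = \<mu>"
      using \<mu> [of w] w by (simp add: Dn1_eq herm_form_eq_norm)
    moreover have "l \<le> 1" "1 \<le> u"
      by (auto simp: l_def u_def)
    ultimately have "w \<in> K" "g w \<in> K"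
      using w by (auto simp: K_def)
    then show ?thesis
      by blast
  qed
  then have "?T \<subseteq> {g \<in> \<Gamma>. g ` K \<inter> K \<noteq> {}}"
    by blast
  ultimately show ?thesis
    by (rule finite_subset [rotated])
next
  case False
  then have "?T = {}"
    by auto
  then show ?thesis
    by (simp only: finite.emptyI)
qed

section \<open>Orbits and compact quotients\<close>

lemma orbit_map_eq_iff:
  assumes G: "aut_subgroup S G" and y: "y \<in> S"
  shows "orbit_map G x = orbit_map G y \<longleftrightarrow> (\<exists>g\<in>G. x = g y)"
proof
  assume "orbit_map G x = orbit_map G y"
  moreover have "x \<in> orbit_map G x"
    unfolding orbit_map_def using G by (intro CollectI exI [of _ id]) (auto simp: aut_subgroup_def)
  ultimately show "\<exists>g\<in>G. x = g y"
    by (auto simp: orbit_map_def)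
next
  assume "\<exists>g\<in>G. x = g y"
  then obtain g where g: "g \<in> G" "x = g y"
    by blast
  have bij: "bij_betw g S S"
    using G g by (auto simp: aut_subgroup_def Aut_def)
  have gy: "aut_inv S g x = y"
    using bij_betw_inv_into_left [OF bij y] bij_betw_apply [OF bij y] by (simp add: aut_inv_def g)
  have inv: "aut_inv S g \<in> G"
    using G g by (simp add: aut_subgroup_def)
  have comp: "h \<circ> k \<in> G" if "h \<in> G" "k \<in> G" for h k
    using G that by (simp add: aut_subgroup_def)
  show "orbit_map G x = orbit_map G y"
  proof (intro set_eqI iffI)
    fix p assume "p \<in> orbit_map G x"
    then obtain h where "h \<in> G" "p = h x"
      by (auto simp: orbit_map_def)
    then show "p \<in> orbit_map G y"
      unfolding orbit_map_def using comp g by (intro CollectI exI [of _ "h \<circ> g"]) auto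
  next
    fix p assume "p \<in> orbit_map G y"
    then obtain h where "h \<in> G" "p = h y"
      by (auto simp: orbit_map_def)
    then show "p \<in> orbit_map G x"
      unfolding orbit_map_def using comp inv gy
      by (intro CollectI exI [of _ "h \<circ> aut_inv S g"]) auto
  qed
qed

lemma open_image_Aut:
  assumes "open S" "g \<in> Aut S" "open U" "U \<subseteq> S"
  shows "open (g ` U)"
proof -
  have bij: "bij_betw g S S" and "holo_on S (aut_inv S g)"
    using assms by (auto simp: Aut_def)
  then have "open (S \<inter> aut_inv S g -` U)"
    using assms by (intro continuous_open_preimage holo_on_imp_continuous_on) auto
  moreover have "g ` U = S \<inter> aut_inv S g -` U"
  proof (intro set_eqI iffI)
    fix x assume "x \<in> g ` U"
    then show "x \<in> S \<inter> aut_inv S g -` U"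
      using assms(4) bij_betw_apply [OF bij] bij_betw_inv_into_left [OF bij]
      by (auto simp: aut_inv_def subset_eq)
  next
    fix x assume "x \<in> S \<inter> aut_inv S g -` U"
    then show "x \<in> g ` U"
      using bij_betw_inv_into_right [OF bij, of x] by (force simp: aut_inv_def)
  qed
  ultimately show ?thesis
    by simp
qed

text \<open>The union of all translates of \<open>U m\<close> is open and saturated, so the images
  of the \<open>U m\<close> form an increasing open cover of the quotient; the largest index of a
  finite subcover suffices.\<close>

lemma compact_quotient_exhaustion:
  assumes S: "open S" and G: "aut_subgroup S G" and cq: "compact_quotient S G"
    and U: "\<And>m::nat. open (U m)" "incseq U" "(\<Union>m. U m) = S"
  shows "\<exists>m. \<forall>x\<in>S. \<exists>g\<in>G. \<exists>y\<in>U m. x = g y"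
proof -
  obtain Y where Y: "quotient_map (top_of_set S) Y (orbit_map G)" "compact_space Y"
    using cq by (auto simp: compact_quotient_def)
  have US: "U m \<subseteq> S" for m
    using U(3) by blast
  have top: "topspace Y = orbit_map G ` S"
    using quotient_imp_surjective_map [OF Y(1)] by simp
  define V where "V m = orbit_map G ` U m" for m
  have V: "openin Y (V m)" for m
  proof -
    have "{x \<in> S. orbit_map G x \<in> V m} = (\<Union>g\<in>G. g ` U m)"
    proof -
      have "g y \<in> S" if "g \<in> G" "y \<in> U m" for g y
        using G that US by (auto simp: aut_subgroup_def Aut_def dest!: subsetD intro: bij_betw_apply)
      moreover have "orbit_map G x \<in> V m \<longleftrightarrow> (\<exists>y\<in>U m. \<exists>g\<in>G. x = g y)" for x
        using orbit_map_eq_iff [OF G, of _ x] US unfolding V_def by blast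
      ultimately show ?thesis
        by auto
    qed
    moreover have "open (\<Union>g\<in>G. g ` U m)"
      using G US U(1) S by (intro open_UN ballI open_image_Aut) (auto simp: aut_subgroup_def)
    ultimately have "openin (top_of_set S) {x \<in> S. orbit_map G x \<in> V m}"
      by (auto simp: openin_open_eq [OF S])
    moreover have "V m \<subseteq> topspace Y"
      using US top by (auto simp: V_def)
    ultimately show ?thesis
      using Y(1) by (simp add: quotient_map_def)
  qed
  have "\<Union> (range V) = topspace Y"
    unfolding top V_def U(3) [symmetric] by blast
  then obtain \<F> where \<F>: "finite \<F>" "\<F> \<subseteq> range V" "\<Union> \<F> = topspace Y"
    using Y(2) V unfolding compact_space by (metis (no_types, lifting) imageE)
  then obtain I where I: "finite I" "\<F> = V ` I"
    by (meson finite_subset_image)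
  \<comment> \<open>Inserting 0 keeps the maximum meaningful when \<open>I\<close> is empty.\<close>
  define m where "m = Max (insert 0 I)"
  have "\<exists>g\<in>G. \<exists>y\<in>U m. x = g y" if x: "x \<in> S" for x
  proof -
    have "orbit_map G x \<in> \<Union> \<F>"
      using x by (simp add: \<F>(3) top)
    then obtain i y where i: "i \<in> I" "y \<in> U i" "orbit_map G x = orbit_map G y"
      by (auto simp: I V_def)
    then have "y \<in> U m"
      using I(1) incseqD [OF U(2), of i m] by (auto simp: m_def)
    then show ?thesis
      using i(3) orbit_map_eq_iff [OF G, of y x] US by blast
  qed
  then show ?thesis
    by blast
qed

theorem theorem4p1:
  fixes e0 :: "'n::finite" and \<Gamma> :: "(complex^'n \<Rightarrow> complex^'n) set"
  assumes "CARD('n) \<ge> 3"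
  shows "\<not> (aut_subgroup (Dn1 e0) \<Gamma> \<and> discrete_in_aut (Dn1 e0) \<Gamma> \<and>
            properly_discontinuous (Dn1 e0) \<Gamma> \<and> compact_quotient (Dn1 e0) \<Gamma>)"
proof
  let ?D = "Dn1 e0" and ?q = "herm_form e0"
  assume A: "aut_subgroup ?D \<Gamma> \<and> discrete_in_aut ?D \<Gamma> \<and>
    properly_discontinuous ?D \<Gamma> \<and> compact_quotient ?D \<Gamma>"
  then have \<Gamma>: "\<Gamma> \<subseteq> Aut ?D"
    by (simp add: aut_subgroup_def)
  \<comment> \<open>An exhaustion of \<open>Dn1\<close> by open sets whose closures are compact
    subsets of \<open>Dn1\<close>: points stay bounded and away from the null cone.\<close>
  define U where "U m = {z. 1 / real (Suc m) < ?q z} \<inter> ball 0 (real m)" for m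
  have "open (U m)" for m
    unfolding U_def by (intro open_Int open_Collect_less continuous_intros open_ball)
  moreover have "incseq U"
  proof (rule incseq_SucI)
    show "U m \<subseteq> U (Suc m)" for m
    proof -
      have "1 / real (Suc (Suc m)) \<le> 1 / real (Suc m)"
        by (simp add: frac_le)
      then show ?thesis
        by (auto simp: U_def)
    qed
  qed
  moreover have "(\<Union>m. U m) = ?D"
  proof (intro set_eqI iffI)
    fix z assume "z \<in> (\<Union>m. U m)"
    then obtain m where "1 / real (Suc m) < ?q z"
      by (auto simp: U_def)
    then show "z \<in> ?D"
      using less_trans [of 0 "1 / real (Suc m)"] by (simp add: Dn1_eq)
  next
    fix z assume "z \<in> ?D"
    then have "0 < ?q z"
      by (simp add: Dn1_eq)
    then obtain k where k: "1 / real (Suc k) < ?q z"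
      using nat_approx_posE by blast
    obtain l where l: "norm z < real l"
      using reals_Archimedean2 by blast
    have "1 / real (Suc (max k l)) \<le> 1 / real (Suc k)"
      by (simp add: frac_le)
    then have "z \<in> U (max k l)"
      using k l by (simp add: U_def)
    then show "z \<in> (\<Union>m. U m)"
      by blast
  qed
  ultimately obtain m where m: "\<And>x. x \<in> ?D \<Longrightarrow> \<exists>g\<in>\<Gamma>. \<exists>y\<in>U m. x = g y"
    using compact_quotient_exhaustion [OF open_Dn1, of e0 \<Gamma> U] A by metis
  define a where "a = 1 / real (Suc m)"
  define K where "K = {z. a \<le> ?q z} \<inter> cball 0 (real m)"
  \<comment> \<open>Contains every group element that carries a point of \<open>U m\<close> into the
    level set of value 1, since the form is at most the squared norm.\<close>
  define T where "T = {g \<in> \<Gamma>. \<exists>z. a \<le> ?q z \<and> ?q z \<le> (real m)\<^sup>2 \<and> ?q (g z) = 1}"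
  have a: "0 < a"
    by (simp add: a_def)
  have "compact K"
    unfolding K_def
    by (intro closed_Int_compact closed_Collect_le continuous_intros compact_cball)
  have KD: "K \<subseteq> ?D"
    using a by (auto simp: K_def Dn1_eq)
  have "finite T"
    unfolding T_def using assms \<Gamma> A a by (intro finite_conformal_factor_bounded) auto
  moreover have "compact (g ` K)" if "g \<in> T" for g
  proof -
    have "holo_on ?D g"
      using that \<Gamma> by (auto simp: T_def Aut_def)
    then show ?thesis
      using \<open>compact K\<close> KD
      by (intro compact_continuous_image) (auto intro: continuous_on_subset holo_on_imp_continuous_on)
  qed
  ultimately have "compact (\<Union>g\<in>T. g ` K)"
    by (intro compact_UN) auto
  then obtain M where M: "\<And>x. x \<in> (\<Union>g\<in>T. g ` K) \<Longrightarrow> norm x \<le> M"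
    using compact_imp_bounded bounded_iff by metis
  obtain e1 where e1: "e1 \<noteq> e0"
    using obtain_two_other_indices [OF assms] .
  \<comment> \<open>A point on the hyperboloid of form value 1 whose coordinate \<open>e1\<close>
    already exceeds the bound \<open>M\<close> on the finitely many translates of
    \<open>K\<close>.\<close>
  define x :: "complex^'n" where "x = axis e1 (of_real (sqrt (1 + M\<^sup>2))) + axis e0 (of_real M)"
  have x_nth: "x $ i = (if i = e1 then of_real (sqrt (1 + M\<^sup>2)) else if i = e0 then of_real M else 0)" for i
    using e1 by (simp add: x_def axis_def)
  have q_x: "?q x = 1"
  proof -
    have "(\<Sum>i\<in>UNIV - {e0}. (cmod (x $ i))\<^sup>2) = (\<Sum>i\<in>UNIV - {e0}. if i = e1 then 1 + M\<^sup>2 else 0)"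
      by (intro sum.cong) (auto simp: x_nth)
    then show ?thesis
      using e1 by (simp add: herm_form_def x_nth)
  qed
  then obtain g y where gy: "g \<in> \<Gamma>" "y \<in> U m" "x = g y"
    using m [of x] by (auto simp: Dn1_eq)
  have "?q y \<le> (norm y)\<^sup>2"
    by (simp add: herm_form_eq_norm)
  also have "\<dots> \<le> (real m)\<^sup>2"
    using gy(2) by (intro power_mono) (auto simp: U_def)
  finally have "g \<in> T"
    using gy q_x by (auto simp: T_def U_def a_def intro!: exI [of _ y])
  moreover have "y \<in> K"
    using gy(2) by (auto simp: K_def U_def a_def)
  ultimately have "norm x \<le> M"
    using gy(3) M by blast
  moreover have "M < sqrt (1 + M\<^sup>2)"
    by (intro real_less_rsqrt) simp
  then have "M < cmod (x $ e1)"
    by (simp add: x_nth)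
  ultimately show False
    using Finite_Cartesian_Product.norm_nth_le [of x e1] by simp
qed

end
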